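(* Let $G$ and $H$ be graphs. If $G$ is Type 1 and $H$ is bipartite, then the direct product $G\times H$ is Type 1.
   Context: Graphs are finite and simple, with nonempty vertex set. The direct product $G\times H$ of graphs $G$ and $H$ has vertex set $V(G)\times V(H)$, with $(u,v)$ and $(u',v')$ adjacent if and only if $uu'\in E(G)$ and $vv'\in E(H)$. A $k$-total coloring of a graph $G$ is an assignment of $k$ colors to its elements (vertices and edges) such that any two adjacent vertices, any two adjacent edges (distinct edges sharing an endpoint), and any edge and each of its endpoints receive distinct colors. The total chromatic number $\chi_T(G)$ is the smallest $k$ for which $G$ has a $k$-total coloring. $\Delta(G)$ denotes the maximum degree. $G$ is Type 1 if $\chi_T(G)=\Delta(G)+1$. *)

theory Defs
  imports "Graph_Theory.Pair_Digraph"
begin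

text \<open>
  Undirected graphs are symmetric, loop-free, finite digraphs without parallel arcs
  (\<^locale>\<open>pair_graph\<close>).  An undirected edge is represented by the two-element set of its
  endpoints, so that the two opposite arcs \<^term>\<open>(u, v)\<close> and \<^term>\<open>(v, u)\<close> form one edge.
\<close>

definition simple_graph :: "'a pair_pre_digraph \<Rightarrow> bool" where
  "simple_graph G \<longleftrightarrow> pair_graph G \<and> pverts G \<noteq> {}"

definition edges :: "'a pair_pre_digraph \<Rightarrow> 'a set set" where
  "edges G = {{u, v} | u v. (u, v) \<in> parcs G}"

text \<open>In a symmetric digraph the out-degree of a vertex is its number of neighbours.\<close>

definition max_degree :: "'a pair_pre_digraph \<Rightarrow> nat" where
  "max_degree G = Max (out_degree (with_proj G) ` pverts G)"

definition bipartite :: "'a pair_pre_digraph \<Rightarrow> bool" where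
  "bipartite G \<longleftrightarrow> (\<exists>A B. A \<union> B = pverts G \<and> A \<inter> B = {} \<and>
     (\<forall>(u, v) \<in> parcs G. (u \<in> A \<and> v \<in> B) \<or> (u \<in> B \<and> v \<in> A)))"

definition direct_product ::
    "'a pair_pre_digraph \<Rightarrow> 'b pair_pre_digraph \<Rightarrow> ('a \<times> 'b) pair_pre_digraph" where
  "direct_product G H =
     \<lparr> pverts = pverts G \<times> pverts H,
       parcs = {((u, v), (u', v')) | u v u' v'. (u, u') \<in> parcs G \<and> (v, v') \<in> parcs H} \<rparr>"

text \<open>The elements of a graph are its vertices (tagged \<^const>\<open>Inl\<close>) and edges (tagged \<^const>\<open>Inr\<close>).\<close>

definition elements :: "'a pair_pre_digraph \<Rightarrow> ('a + 'a set) set" where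
  "elements G = pverts G <+> edges G"

definition total_coloring ::
    "'a pair_pre_digraph \<Rightarrow> nat \<Rightarrow> ('a + 'a set \<Rightarrow> nat) \<Rightarrow> bool" where
  "total_coloring G k c \<longleftrightarrow>
     (\<forall>x \<in> elements G. c x < k) \<and>
     (\<forall>(u, v) \<in> parcs G. c (Inl u) \<noteq> c (Inl v)) \<and>
     (\<forall>e \<in> edges G. \<forall>f \<in> edges G. e \<noteq> f \<and> e \<inter> f \<noteq> {} \<longrightarrow> c (Inr e) \<noteq> c (Inr f)) \<and>
     (\<forall>e \<in> edges G. \<forall>v \<in> e. c (Inr e) \<noteq> c (Inl v))"

definition total_chromatic_number :: "'a pair_pre_digraph \<Rightarrow> nat" where
  "total_chromatic_number G = (LEAST k. \<exists>c. total_coloring G k c)"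

definition type_1 :: "'a pair_pre_digraph \<Rightarrow> bool" where
  "type_1 G \<longleftrightarrow> total_chromatic_number G = max_degree G + 1"

text \<open>A total coloring always exists, so the minimum above is attained.\<close>

lemma total_coloring_exists:
  assumes "simple_graph G"
  shows "\<exists>k c. total_coloring G k c"
proof -
  interpret pair_graph G using assms by (simp add: simple_graph_def)
  have "edges G = (\<lambda>(u, v). {u, v}) ` parcs G"
    by (force simp: edges_def)
  then have "finite (elements G)"
    by (simp add: elements_def)
  then obtain c :: "'a + 'a set \<Rightarrow> nat" and k where
      c: "c ` elements G = {i. i < k}" "inj_on c (elements G)"
    using finite_imp_inj_to_nat_seg by metis
  have V: "u \<in> pverts G \<and> v \<in> pverts G \<and> u \<noteq> v" if "(u, v) \<in> parcs G" for u v
    using that in_arcsD1 in_arcsD2 pair_no_loops by fastforce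
  have E: "v \<in> pverts G" if "e \<in> edges G" "v \<in> e" for e v
    using that V by (auto simp: edges_def)
  have "total_coloring G k c"
    unfolding total_coloring_def
    using c(1) V E by (auto simp: elements_def dest!: inj_onD[OF c(2)])
  then show ?thesis by blast
qed

lemma simple_graph_direct_product:
  assumes "simple_graph G" "simple_graph H"
  shows "simple_graph (direct_product G H)"
proof -
  interpret G: pair_graph G using assms by (simp add: simple_graph_def)
  interpret H: pair_graph H using assms by (simp add: simple_graph_def)
  have sub: "parcs (direct_product G H) \<subseteq>
      (pverts G \<times> pverts H) \<times> (pverts G \<times> pverts H)"
    by (auto simp: direct_product_def dest: G.in_arcsD1 G.in_arcsD2 H.in_arcsD1 H.in_arcsD2)
  have "sym (parcs G)" "sym (parcs H)"
    using G.pair_sym_arcs H.pair_sym_arcs by (simp_all add: symmetric_def)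
  then have "sym (parcs (direct_product G H))"
    by (auto simp: direct_product_def sym_def)
  moreover have "finite (parcs (direct_product G H))"
    using sub by (rule finite_subset) (simp add: G.pair_finite_verts H.pair_finite_verts)
  ultimately have "pair_graph (direct_product G H)"
    using sub G.pair_no_loops
    by unfold_locales
      (fastforce simp: direct_product_def symmetric_def G.pair_finite_verts H.pair_finite_verts)+
  then show ?thesis
    using assms by (simp add: simple_graph_def direct_product_def)
qed

end

theory Submission
  imports Defs
begin

text \<open>
  Let \<open>\<Delta>\<close> and \<open>d\<close> be the maximum degrees of \<open>G\<close> and \<open>H\<close>; the product has maximum degree \<open>\<Delta> d\<close>.
  By Koenig's edge colouring theorem \<open>H\<close> splits into matchings \<open>M\<^sub>0, \<dots>, M\<^bsub>d-1\<^esub>\<close>.  Colour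
  every vertex \<open>(u, a)\<close> of the product and every edge lying over \<open>M\<^sub>0\<close> by its projection to \<open>G\<close>,
  using a total colouring of \<open>G\<close> with \<open>\<Delta> + 1\<close> colours.  For \<open>i > 0\<close>, the edges over \<open>M\<^sub>i\<close> form
  disjoint copies of the bipartite double cover of \<open>G\<close>, so by Koenig's theorem again they can be
  coloured with \<open>\<Delta>\<close> fresh colours.  This uses \<open>\<Delta> + 1 + (d - 1) \<Delta> = \<Delta> d + 1\<close> colours.
\<close>

section \<open>Edge colourings of bipartite graphs\<close>

text \<open>A relation is read as a bipartite graph whose sides are the two coordinates (rows and
  columns), even when both have the same type. So \<open>parcs G\<close> stands for the bipartite
  double cover of \<open>G\<close>, and \<open>f\<close> is a proper edge colouring.\<close>

definition line_coloring :: "('a \<times> 'b) set \<Rightarrow> nat \<Rightarrow> ('a \<Rightarrow> 'b \<Rightarrow> nat) \<Rightarrow> bool" where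
  "line_coloring R k f \<longleftrightarrow>
     (\<forall>x y. (x, y) \<in> R \<longrightarrow> f x y < k) \<and>
     (\<forall>x y y'. (x, y) \<in> R \<longrightarrow> (x, y') \<in> R \<longrightarrow> f x y = f x y' \<longrightarrow> y = y') \<and>
     (\<forall>x x' y. (x, y) \<in> R \<longrightarrow> (x', y) \<in> R \<longrightarrow> f x y = f x' y \<longrightarrow> x = x')"

lemma line_coloringD:
  assumes "line_coloring R k f"
  shows "(x, y) \<in> R \<Longrightarrow> f x y < k"
    and "(x, y) \<in> R \<Longrightarrow> (x, y') \<in> R \<Longrightarrow> f x y = f x y' \<Longrightarrow> y = y'"
    and "(x, y) \<in> R \<Longrightarrow> (x', y) \<in> R \<Longrightarrow> f x y = f x' y \<Longrightarrow> x = x'"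
  using assms unfolding line_coloring_def by blast+

lemma exists_missing_color:
  assumes "finite N" "card N < k"
  shows "\<exists>i<k. \<forall>y\<in>N. h y \<noteq> (i::nat)"
proof -
  have "card (h ` N) < card {..<k}"
    using card_image_le[OF assms(1), of h] assms(2) by simp
  then have "\<not> {..<k} \<subseteq> h ` N"
    using card_mono[of "h ` N" "{..<k}"] assms(1) by auto
  then show ?thesis by auto
qed

text \<open>Prepares the insertion of a new pair \<open>(a, b)\<close>: \<alpha> is free in row
  \<open>a\<close> and \<beta> in column \<open>b\<close>. Exchanging the two colours along the
  alternating path from \<open>b\<close> frees \<alpha> at both ends.\<close>

lemma line_coloring_kempe_swap:
  assumes f: "line_coloring R k f" and "\<alpha> < k" "\<beta> < k"
    and a: "\<And>y. (a, y) \<in> R \<Longrightarrow> f a y \<noteq> \<alpha>"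
    and b: "\<And>x. (x, b) \<in> R \<Longrightarrow> f x b \<noteq> \<beta>"
  shows "\<exists>f'. line_coloring R k f' \<and>
    (\<forall>y. (a, y) \<in> R \<longrightarrow> f' a y \<noteq> \<alpha>) \<and> (\<forall>x. (x, b) \<in> R \<longrightarrow> f' x b \<noteq> \<alpha>)"
proof (cases "\<alpha> = \<beta>")
  case True
  then show ?thesis using assms by blast
next
  case False
  \<comment> \<open>\<open>Y\<close> and \<open>X\<close> are the columns and rows on the alternating path that leaves \<open>b\<close> by an
    \<open>\<alpha>\<close>-entry; it enters rows only through \<open>\<alpha>\<close>-entries, hence never meets \<open>a\<close>.\<close>
  define T where "T = {(y, y'). \<exists>x. (x, y) \<in> R \<and> f x y = \<alpha> \<and> (x, y') \<in> R \<and> f x y' = \<beta>}"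
  define Y where "Y = T\<^sup>* `` {b}"
  define X where "X = {x. \<exists>y\<in>Y. (x, y) \<in> R \<and> f x y = \<alpha>}"
  define f' where "f' x y = (if x \<in> X then if f x y = \<alpha> then \<beta> else if f x y = \<beta> then \<alpha> else f x y
    else f x y)" for x y
  have "a \<notin> X" using a by (auto simp: X_def)
  have "b \<in> Y" by (simp add: Y_def)
  have step: "y' \<in> Y" if "x \<in> X" "(x, y') \<in> R" "f x y' = \<beta>" for x y'
    using that unfolding X_def Y_def T_def by (auto intro: rtrancl_into_rtrancl)
  \<comment> \<open>The path reaches \<open>y\<close> \<noteq> \<open>b\<close> through a
    \<beta>-entry of its last row, and column \<open>y\<close> has only one \<beta>-entry.\<close>
  have step_back: "x \<in> X" if "y \<in> Y" "(x, y) \<in> R" "f x y = \<beta>" for x y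
  proof -
    have "y \<noteq> b" using that b by auto
    moreover have "(b, y) \<in> T\<^sup>*" using \<open>y \<in> Y\<close> by (simp add: Y_def)
    ultimately obtain z where "(b, z) \<in> T\<^sup>*" "(z, y) \<in> T"
      by (metis rtranclE)
    then obtain x' where "(x', z) \<in> R" "f x' z = \<alpha>" "(x', y) \<in> R" "f x' y = \<beta>" "z \<in> Y"
      by (auto simp: T_def Y_def)
    moreover from this have "x' = x" using that line_coloringD(3)[OF f] by metis
    ultimately show ?thesis by (auto simp: X_def)
  qed
  have iff: "x \<in> X \<longleftrightarrow> y \<in> Y" if xy: "(x, y) \<in> R" "f x y = \<alpha> \<or> f x y = \<beta>" for x y
  proof (cases "f x y = \<alpha>")
    case True
    then show ?thesis using xy line_coloringD(2)[OF f] by (auto simp: X_def)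
  next
    case False
    then show ?thesis using xy step step_back by blast
  qed
  \<comment> \<open>By \<open>iff\<close>, exchanging the colours in the rows of \<open>X\<close> is
    the same as exchanging them in the columns of \<open>Y\<close>. The definition of
    \<open>f'\<close> gives the row condition, this form the column condition.\<close>
  have col: "f' x y = (if y \<in> Y then if f x y = \<alpha> then \<beta> else if f x y = \<beta> then \<alpha> else f x y
    else f x y)" if "(x, y) \<in> R" for x y
    using iff[OF that] unfolding f'_def by auto
  have "line_coloring R k f'"
    unfolding line_coloring_def
  proof (intro conjI allI impI)
    show "f' x y < k" if "(x, y) \<in> R" for x y
      using line_coloringD(1)[OF f that] \<open>\<alpha> < k\<close> \<open>\<beta> < k\<close> by (auto simp: f'_def)
    show "y = y'" if "(x, y) \<in> R" "(x, y') \<in> R" "f' x y = f' x y'" for x y y'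
      using that line_coloringD(2)[OF f that(1,2)] False
      by (auto simp: f'_def split: if_splits)
    show "x = x'" if "(x, y) \<in> R" "(x', y) \<in> R" "f' x y = f' x' y" for x x' y
      using that(3) line_coloringD(3)[OF f that(1,2)] False
      by (auto simp: col[OF that(1)] col[OF that(2)] split: if_splits)
  qed
  moreover have "f' a y \<noteq> \<alpha>" if "(a, y) \<in> R" for y
    using a[OF that] \<open>a \<notin> X\<close> by (simp add: f'_def)
  moreover have "f' x b \<noteq> \<alpha>" if "(x, b) \<in> R" for x
    using b[OF that] \<open>b \<in> Y\<close> False by (simp add: col[OF that])
  ultimately show ?thesis by blast
qed

text \<open>Induction on the pairs: before \<open>(a, b)\<close> is added, row \<open>a\<close> and
  column \<open>b\<close> have degree below \<open>k\<close>, so each misses a colour. A Kempe swap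
  makes it a common one, which the new pair receives.\<close>

lemma koenig_line_coloring:
  assumes "finite R" "\<And>x. card (R `` {x}) \<le> k" "\<And>y. card (R\<inverse> `` {y}) \<le> k"
  shows "\<exists>f. line_coloring R k f"
  using assms
proof (induction R rule: finite_induct)
  case empty
  then show ?case by (simp add: line_coloring_def)
next
  case (insert p R)
  obtain a b where p: "p = (a, b)" by (cases p)
  have fin: "finite (insert p R `` S)" "finite ((insert p R)\<inverse> `` S')" for S S'
    using insert.hyps(1) by (auto intro: finite_Image)
  have fin': "finite (R `` {x})" "finite (R\<inverse> `` {y})" for x y
    using insert.hyps(1) by (auto intro: finite_Image)
  have "card (R `` {x}) \<le> card (insert p R `` {x})"
    "card (R\<inverse> `` {y}) \<le> card ((insert p R)\<inverse> `` {y})" for x y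
    by (intro card_mono fin; blast)+
  then obtain f where f: "line_coloring R k f"
    using insert.IH insert.prems by (meson order_trans)
  have "insert p R `` {a} = insert b (R `` {a})" "b \<notin> R `` {a}"
    using insert.hyps(2) p by auto
  then have "card (R `` {a}) < k"
    using insert.prems(1)[of a] fin'(1)[of a] by simp
  then obtain \<alpha> where \<alpha>: "\<alpha> < k" "\<forall>y \<in> R `` {a}. f a y \<noteq> \<alpha>"
    using exists_missing_color[OF fin'(1)] by metis
  have "(insert p R)\<inverse> `` {b} = insert a (R\<inverse> `` {b})" "a \<notin> R\<inverse> `` {b}"
    using insert.hyps(2) p by auto
  then have "card (R\<inverse> `` {b}) < k"
    using insert.prems(2)[of b] fin'(2)[of b] by simp
  then obtain \<beta> where \<beta>: "\<beta> < k" "\<forall>x \<in> R\<inverse> `` {b}. f x b \<noteq> \<beta>"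
    using exists_missing_color[OF fin'(2), of b k "\<lambda>x. f x b"] by metis
  obtain f' where f': "line_coloring R k f'"
      "\<forall>y. (a, y) \<in> R \<longrightarrow> f' a y \<noteq> \<alpha>" "\<forall>x. (x, b) \<in> R \<longrightarrow> f' x b \<noteq> \<alpha>"
    using line_coloring_kempe_swap[OF f \<alpha>(1) \<beta>(1), of a b] \<alpha>(2) \<beta>(2) by auto
  let ?g = "\<lambda>x y. if (x, y) = p then \<alpha> else f' x y"
  have "line_coloring (insert p R) k ?g"
    unfolding line_coloring_def
  proof (intro conjI allI impI)
    show "?g x y < k" if "(x, y) \<in> insert p R" for x y
      using that line_coloringD(1)[OF f'(1)] \<alpha>(1) by auto
    show "y = y'" if "(x, y) \<in> insert p R" "(x, y') \<in> insert p R" "?g x y = ?g x y'" for x y y'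
      using that line_coloringD(2)[OF f'(1), of x y y'] f'(2) p by (auto split: if_splits)
    show "x = x'" if "(x, y) \<in> insert p R" "(x', y) \<in> insert p R" "?g x y = ?g x' y" for x x' y
      using that line_coloringD(3)[OF f'(1), of x y x'] f'(3) p by (auto split: if_splits)
  qed
  then show ?case by blast
qed

section \<open>Degrees and total colourings\<close>

lemma simple_graphD:
  assumes "simple_graph G"
  shows "finite (pverts G)" "finite (parcs G)" "pverts G \<noteq> {}" "sym (parcs G)"
    and "(u, v) \<in> parcs G \<Longrightarrow> u \<in> pverts G \<and> v \<in> pverts G \<and> u \<noteq> v"
proof -
  interpret pair_graph G using assms by (simp add: simple_graph_def)
  show "finite (pverts G)" "finite (parcs G)" by (rule pair_finite_verts pair_finite_arcs)+
  show "pverts G \<noteq> {}" using assms by (simp add: simple_graph_def)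
  show "sym (parcs G)" using pair_sym_arcs by (simp add: symmetric_def)
  show "(u, v) \<in> parcs G \<Longrightarrow> u \<in> pverts G \<and> v \<in> pverts G \<and> u \<noteq> v"
    using in_arcsD1 in_arcsD2 pair_no_loops by fastforce
qed

lemma out_degree_eq_card_Image: "out_degree (with_proj G) v = card (parcs G `` {v})"
proof -
  have "out_arcs (with_proj G) v = Pair v ` (parcs G `` {v})"
    by (auto simp: out_arcs_def)
  then show ?thesis
    unfolding out_degree_def by (simp add: card_image inj_on_def)
qed

lemma card_neighbours_le_max_degree:
  assumes "simple_graph G"
  shows "card (parcs G `` {v}) \<le> max_degree G"
proof (cases "v \<in> pverts G")
  case True
  then show ?thesis
    unfolding max_degree_def using simple_graphD(1)[OF assms]
    by (simp add: flip: out_degree_eq_card_Image)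
next
  case False
  then have "parcs G `` {v} = {}" using simple_graphD(5)[OF assms] by auto
  then show ?thesis by simp
qed

lemma max_degree_attained:
  assumes "simple_graph G"
  obtains v where "v \<in> pverts G" "card (parcs G `` {v}) = max_degree G"
proof -
  have "max_degree G \<in> out_degree (with_proj G) ` pverts G"
    unfolding max_degree_def using simple_graphD(1,3)[OF assms] by (intro Max_in) auto
  then show ?thesis using that by (auto simp: out_degree_eq_card_Image)
qed

text \<open>The neighbourhood of \<open>(u, a)\<close> is the product of the neighbourhoods of
  \<open>u\<close> and \<open>a\<close>, so degrees multiply.\<close>

lemma max_degree_direct_product:
  assumes "simple_graph G" "simple_graph H"
  shows "max_degree (direct_product G H) = max_degree G * max_degree H"
proof -
  let ?P = "direct_product G H"
  have "parcs ?P `` {(u, a)} = (parcs G `` {u}) \<times> (parcs H `` {a})" for u a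
    by (auto simp: direct_product_def)
  then have card: "card (parcs ?P `` {(u, a)}) = card (parcs G `` {u}) * card (parcs H `` {a})" for u a
    by (simp add: card_cartesian_product)
  note P = simple_graph_direct_product[OF assms]
  obtain p where "card (parcs ?P `` {p}) = max_degree ?P"
    by (rule max_degree_attained[OF P])
  then have "max_degree ?P \<le> max_degree G * max_degree H"
    using card[of "fst p" "snd p"] card_neighbours_le_max_degree assms
    by (metis mult_le_mono prod.collapse)
  moreover obtain u where "card (parcs G `` {u}) = max_degree G"
    by (rule max_degree_attained[OF assms(1)])
  moreover obtain a where "card (parcs H `` {a}) = max_degree H"
    by (rule max_degree_attained[OF assms(2)])
  ultimately show ?thesis
    using card[of u a] card_neighbours_le_max_degree[OF P, of "(u, a)"] by simp
qed

lemma total_coloringD: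
  assumes "total_coloring G k c"
  shows "x \<in> elements G \<Longrightarrow> c x < k"
    and "(u, v) \<in> parcs G \<Longrightarrow> c (Inl u) \<noteq> c (Inl v)"
    and "e \<in> edges G \<Longrightarrow> e' \<in> edges G \<Longrightarrow> e \<inter> e' \<noteq> {} \<Longrightarrow> c (Inr e) = c (Inr e') \<Longrightarrow> e = e'"
    and "e \<in> edges G \<Longrightarrow> v \<in> e \<Longrightarrow> c (Inr e) \<noteq> c (Inl v)"
proof -
  note c = assms[unfolded total_coloring_def]
  show "x \<in> elements G \<Longrightarrow> c x < k"
    by (rule bspec[OF c[THEN conjunct1]])
  show "(u, v) \<in> parcs G \<Longrightarrow> c (Inl u) \<noteq> c (Inl v)"
    using bspec[OF c[THEN conjunct2, THEN conjunct1]] by fastforce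
  show "e \<in> edges G \<Longrightarrow> e' \<in> edges G \<Longrightarrow> e \<inter> e' \<noteq> {} \<Longrightarrow> c (Inr e) = c (Inr e') \<Longrightarrow> e = e'"
    using c[THEN conjunct2, THEN conjunct2, THEN conjunct1] by metis
  show "e \<in> edges G \<Longrightarrow> v \<in> e \<Longrightarrow> c (Inr e) \<noteq> c (Inl v)"
    using c[THEN conjunct2, THEN conjunct2, THEN conjunct2] by metis
qed

text \<open>A vertex of maximum degree and its incident edges need pairwise distinct
  colours.\<close>

lemma total_coloring_gt_max_degree:
  assumes "simple_graph G" "total_coloring G k c"
  shows "max_degree G + 1 \<le> k"
proof -
  obtain v where v: "v \<in> pverts G" "card (parcs G `` {v}) = max_degree G"
    by (rule max_degree_attained[OF assms(1)])
  let ?N = "parcs G `` {v}"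
  have fin: "finite ?N" using simple_graphD(2)[OF assms(1)] by (rule finite_Image)
  have E: "{v, w} \<in> edges G" if "w \<in> ?N" for w using that by (auto simp: edges_def)
  have inj: "inj_on (\<lambda>w. c (Inr {v, w})) ?N"
  proof (rule inj_onI)
    fix w w' assume w: "w \<in> ?N" "w' \<in> ?N" "c (Inr {v, w}) = c (Inr {v, w'})"
    have "{v, w} = {v, w'}"
      by (rule total_coloringD(3)[OF assms(2) E[OF w(1)] E[OF w(2)] _ w(3)]) simp
    then show "w = w'" by (metis doubleton_eq_iff)
  qed
  have "c (Inl v) \<notin> (\<lambda>w. c (Inr {v, w})) ` ?N"
    using total_coloringD(4)[OF assms(2) E, of _ v] by force
  then have "card (insert (c (Inl v)) ((\<lambda>w. c (Inr {v, w})) ` ?N)) = max_degree G + 1"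
    using fin v(2) by (simp add: card_image[OF inj])
  moreover have "insert (c (Inl v)) ((\<lambda>w. c (Inr {v, w})) ` ?N) \<subseteq> {..<k}"
    using E v(1) total_coloringD(1)[OF assms(2)] by (auto simp: elements_def)
  ultimately show ?thesis
    using card_mono[OF finite_lessThan] by (metis card_lessThan)
qed

text \<open>Reduces Type 1 to exhibiting one colouring, since the lower bound already makes this
  number of colours least possible.\<close>

lemma type_1_iff:
  assumes "simple_graph G"
  shows "type_1 G \<longleftrightarrow> (\<exists>c. total_coloring G (max_degree G + 1) c)"
proof
  assume "type_1 G"
  moreover have "\<exists>c. total_coloring G (total_chromatic_number G) c"
    unfolding total_chromatic_number_def by (rule LeastI_ex[OF total_coloring_exists[OF assms]])
  ultimately show "\<exists>c. total_coloring G (max_degree G + 1) c" by (simp add: type_1_def)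
next
  assume "\<exists>c. total_coloring G (max_degree G + 1) c"
  then show "type_1 G"
    unfolding type_1_def total_chromatic_number_def
    using total_coloring_gt_max_degree[OF assms] by (intro Least_equality) auto
qed

text \<open>An orientation \<open>D\<close> of all edges from one side of a bipartition to the other turns edge
  colourings into line colourings of the relation \<open>D\<close>.\<close>

lemma total_coloring_of_bipartite:
  assumes cv: "\<And>p. p \<in> pverts P \<Longrightarrow> cv p < k" "\<And>p q. (p, q) \<in> parcs P \<Longrightarrow> cv p \<noteq> cv q"
    and ce: "line_coloring D k ce"
    and inc: "\<And>p q. (p, q) \<in> D \<Longrightarrow> ce p q \<noteq> cv p \<and> ce p q \<noteq> cv q"
    and cover: "\<And>p q. (p, q) \<in> parcs P \<Longrightarrow> (p, q) \<in> D \<or> (q, p) \<in> D"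
    and sides: "Domain D \<inter> Range D = {}"
  shows "\<exists>c. total_coloring P k c"
proof -
  \<comment> \<open>\<open>h e\<close> picks an oriented pair of \<open>D\<close> that represents
    the unordered edge \<open>e\<close>.\<close>
  define h where "h e = (SOME z. z \<in> D \<and> e = {fst z, snd z})" for e
  define c where "c z = (case z of Inl p \<Rightarrow> cv p | Inr e \<Rightarrow> ce (fst (h e)) (snd (h e)))" for z
  have E: "\<exists>p q. e = {p, q} \<and> (p, q) \<in> D \<and> c (Inr e) = ce p q" if e: "e \<in> edges P" for e
  proof -
    obtain p q where "e = {p, q}" "(p, q) \<in> parcs P" using e by (auto simp: edges_def)
    then have "\<exists>z. z \<in> D \<and> e = {fst z, snd z}" using cover by (metis fst_conv insert_commute snd_conv)
    then have "h e \<in> D \<and> e = {fst (h e), snd (h e)}" unfolding h_def by (rule someI_ex)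
    then show ?thesis
      by (intro exI[of _ "fst (h e)"] exI[of _ "snd (h e)"]) (simp add: c_def)
  qed
  have "total_coloring P k c"
    unfolding total_coloring_def
  proof (intro conjI ballI impI)
    show "c x < k" if "x \<in> elements P" for x
      using that cv(1) E line_coloringD(1)[OF ce] by (fastforce simp: elements_def c_def)
    show "case z of (p, q) \<Rightarrow> c (Inl p) \<noteq> c (Inl q)" if "z \<in> parcs P" for z
      using that cv(2) by (auto simp: c_def)
    show "c (Inr e) \<noteq> c (Inl p)" if e: "e \<in> edges P" "p \<in> e" for e p
    proof -
      obtain x y where "e = {x, y}" "(x, y) \<in> D" "c (Inr e) = ce x y" using E e(1) by blast
      moreover have "c (Inl p) = cv p" by (simp add: c_def)
      ultimately show ?thesis using inc e(2) by auto
    qed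
    show "c (Inr e) \<noteq> c (Inr e')" if ee': "e \<in> edges P" "e' \<in> edges P" "e \<noteq> e' \<and> e \<inter> e' \<noteq> {}" for e e'
    proof -
      obtain x y where e: "e = {x, y}" "(x, y) \<in> D" "c (Inr e) = ce x y" using E ee'(1) by blast
      obtain x' y' where e': "e' = {x', y'}" "(x', y') \<in> D" "c (Inr e') = ce x' y'"
        using E ee'(2) by blast
      \<comment> \<open>The disjoint sides exclude \<open>x = y'\<close> and \<open>y = x'\<close>,
        so a shared endpoint is a shared row or a shared column.\<close>
      have "x = x' \<or> y = y'"
        using ee'(3) e(1,2) e'(1,2) sides by blast
      then show ?thesis
        using e e' ee'(3) line_coloringD(2,3)[OF ce] by metis
    qed
  qed
  then show ?thesis by blast
qed

section \<open>The total colouring of the direct product\<close>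

theorem corollary1:
  fixes G :: "'a pair_pre_digraph" and H :: "'b pair_pre_digraph"
  assumes "simple_graph G" and "simple_graph H"
    and "type_1 G" and "bipartite H"
  shows "type_1 (direct_product G H)"
proof -
  let ?P = "direct_product G H"
  define m where "m = max_degree G"
  define d where "d = max_degree H"
  note G = simple_graphD[OF assms(1)] and H = simple_graphD[OF assms(2)]
  have P: "simple_graph ?P" by (rule simple_graph_direct_product[OF assms(1,2)])
  have parcs_P: "((u, a), (v, b)) \<in> parcs ?P \<longleftrightarrow> (u, v) \<in> parcs G \<and> (a, b) \<in> parcs H" for u v a b
    by (auto simp: direct_product_def)
  have "\<exists>c. total_coloring ?P (m * d + 1) c"
  proof (cases "d = 0")
    \<comment> \<open>Treated apart because \<open>m * d + 1\<close> is then 1, possibly too few for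
      the colours of \<open>c\<close>; without edges one colour suffices.\<close>
    case True
    then have "parcs H `` {a} = {}" for a
      using card_neighbours_le_max_degree[OF assms(2), of a] finite_Image[OF H(2)]
      by (simp add: d_def)
    then have "parcs ?P = {}" by (auto simp: direct_product_def)
    then have "total_coloring ?P (m * d + 1) (\<lambda>_. 0)"
      by (simp add: total_coloring_def edges_def)
    then show ?thesis by blast
  next
    case False
    obtain c where c: "total_coloring G (m + 1) c"
      using assms(3) type_1_iff[OF assms(1)] by (auto simp: m_def)
    have cV_lt: "c (Inl u) < m + 1" if "u \<in> pverts G" for u
      using that by (intro total_coloringD(1)[OF c]) (auto simp: elements_def)
    have cE_lt: "c (Inr e) < m + 1" if "e \<in> edges G" for e
      using that by (intro total_coloringD(1)[OF c]) (auto simp: elements_def)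
    note cV = total_coloringD(2)[OF c] and cE = total_coloringD(3)[OF c]
    have arc_edge: "{u, v} \<in> edges G" if "(u, v) \<in> parcs G" for u v
      using that by (auto simp: edges_def)
    have cVE: "c (Inr {u, v}) \<noteq> c (Inl u)" "c (Inr {u, v}) \<noteq> c (Inl v)"
      if "(u, v) \<in> parcs G" for u v
      using total_coloringD(4)[OF c arc_edge[OF that]] by simp_all
    have c_line: "line_coloring (parcs G) (m + 1) (\<lambda>u v. c (Inr {u, v}))"
      unfolding line_coloring_def
    proof (intro conjI allI impI)
      show "c (Inr {u, v}) < m + 1" if "(u, v) \<in> parcs G" for u v
        by (rule cE_lt[OF arc_edge[OF that]])
      show "v = v'" if "(u, v) \<in> parcs G" "(u, v') \<in> parcs G" "c (Inr {u, v}) = c (Inr {u, v'})" for u v v'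
        using cE[OF that(1,2)[THEN arc_edge] _ that(3)] by (auto simp: doubleton_eq_iff)
      show "u = u'" if "(u, v) \<in> parcs G" "(u', v) \<in> parcs G" "c (Inr {u, v}) = c (Inr {u', v})" for u u' v
        using cE[OF that(1,2)[THEN arc_edge] _ that(3)] by (auto simp: doubleton_eq_iff)
    qed
    have conv: "(parcs G)\<inverse> = parcs G" "(parcs H)\<inverse> = parcs H"
      using G(4) H(4) by (simp_all add: sym_conv_converse_eq)
    \<comment> \<open>Konig on the double cover needs only \<open>m\<close> colours although
      \<open>G\<close> need not be bipartite; \<open>g u v\<close> and \<open>g v u\<close> may
      differ.\<close>
    obtain g where g: "line_coloring (parcs G) m g"
      using koenig_line_coloring[OF G(2), of m] card_neighbours_le_max_degree[OF assms(1)]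
      by (auto simp: conv m_def)
    \<comment> \<open>\<open>f\<close> may also differ on opposite arcs, but only its values on arcs
      from \<open>A\<close> to \<open>B\<close> are used; there its classes are the matchings of
      \<open>H\<close>.\<close>
    obtain f where f: "line_coloring (parcs H) d f"
      using koenig_line_coloring[OF H(2), of d] card_neighbours_le_max_degree[OF assms(2)]
      by (auto simp: conv d_def)
    obtain A B where bip: "A \<inter> B = {}"
        "\<forall>(a, b) \<in> parcs H. (a \<in> A \<and> b \<in> B) \<or> (a \<in> B \<and> b \<in> A)"
      using assms(4) unfolding bipartite_def by (elim exE conjE)
    have AB: "a \<in> A \<and> b \<in> B \<or> a \<in> B \<and> b \<in> A" if "(a, b) \<in> parcs H" for a b
      using bspec[OF bip(2) that] by simp
    define D where "D = {(p, q) \<in> parcs ?P. snd p \<in> A \<and> snd q \<in> B}"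
    have D_iff: "((u, a), (v, b)) \<in> D \<longleftrightarrow> (u, v) \<in> parcs G \<and> (a, b) \<in> parcs H \<and> a \<in> A \<and> b \<in> B"
      for u a v b by (auto simp: D_def parcs_P)
    \<comment> \<open>Class 0 reuses the colours 0, ..., \<open>m\<close> of \<open>c\<close>; class
      \<open>i\<close> > 0 gets the block \<open>m * i + 1\<close>, ..., \<open>m * i + m\<close>.
      The blocks are disjoint and the last, for \<open>i = d - 1\<close>, ends at
      \<open>m * d\<close>.\<close>
    define w where "w i u v = (if i = 0 then c (Inr {u, v}) else m * i + 1 + g u v)" for i u v
    have g_lt: "g u v < m" if "(u, v) \<in> parcs G" for u v
      using line_coloringD(1)[OF g that] .
    have w_lt: "w i u v < m * d + 1" if "(u, v) \<in> parcs G" "i < d" for i u v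
    proof (cases "i = 0")
      case True
      then have "w i u v < m + 1"
        using line_coloringD(1)[OF c_line that(1)] by (simp add: w_def)
      \<comment> \<open>\<open>False\<close> is here the outer assumption \<open>d\<close> \<noteq>
        0.\<close>
      also have "\<dots> \<le> m * d + 1" using False by simp
      finally show ?thesis .
    next
      case False
      have "w i u v < m * (i + 1) + 1" using False g_lt[OF that(1)] by (simp add: w_def)
      also have "\<dots> \<le> m * d + 1" using that(2) by (intro add_mono mult_le_mono) auto
      finally show ?thesis .
    qed
    have w_0: "i = 0 \<longleftrightarrow> w i u v < m + 1" if "(u, v) \<in> parcs G" for i u v
      using line_coloringD(1)[OF c_line that] by (cases i) (auto simp: w_def)
    have w_index: "i = j" if "(u, v) \<in> parcs G" "(u', v') \<in> parcs G" "w i u v = w j u' v'" for i j u v u' v'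
    proof (cases "i = 0")
      case True
      then show ?thesis using w_0 that by metis
    next
      case False
      then have "j \<noteq> 0" using w_0 that by metis
      with False that(3) have "m * i + g u v = m * j + g u' v'" by (simp add: w_def)
      \<comment> \<open>As \<open>g\<close> stays below \<open>m\<close>, the quotient recovers the
        index of the block.\<close>
      then have "(m * i + g u v) div m = (m * j + g u' v') div m" by simp
      then show ?thesis using g_lt[OF that(1)] g_lt[OF that(2)] by simp
    qed
    have w_line: "line_coloring (parcs G) (m * d + 1) (w i)" if "i < d" for i
      using w_lt[OF _ that] c_line g by (cases "i = 0") (auto simp: line_coloring_def w_def)
    define ce where "ce p q = w (f (snd p) (snd q)) (fst p) (fst q)" for p q
    show ?thesis
    proof (rule total_coloring_of_bipartite[where cv = "\<lambda>p. c (Inl (fst p))" and D = D and ce = ce])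
      show "c (Inl (fst p)) < m * d + 1" if "p \<in> pverts ?P" for p
      proof -
        have "c (Inl (fst p)) < m + 1"
          using that cV_lt by (auto simp: direct_product_def)
        also have "\<dots> \<le> m * d + 1" using False by simp
        finally show ?thesis .
      qed
      show "c (Inl (fst p)) \<noteq> c (Inl (fst q))" if "(p, q) \<in> parcs ?P" for p q
        using that cV by (auto simp: direct_product_def)
      show "(p, q) \<in> D \<or> (q, p) \<in> D" if "(p, q) \<in> parcs ?P" for p q
      proof -
        obtain u a v b where pq: "p = (u, a)" "q = (v, b)" by (cases p; cases q)
        have arcs: "(u, v) \<in> parcs G" "(a, b) \<in> parcs H" using that by (simp_all add: pq parcs_P)
        then have "(v, u) \<in> parcs G" "(b, a) \<in> parcs H" using G(4) H(4) by (simp_all add: symD)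
        then show ?thesis using arcs AB[OF arcs(2)] by (auto simp: pq D_iff)
      qed
      show "Domain D \<inter> Range D = {}"
        using bip(1) by (auto simp: D_def)
      \<comment> \<open>In class 0 this is inherited from \<open>c\<close>; in the other classes
        edge colours exceed \<open>m\<close>, vertex colours do not.\<close>
      show "ce p q \<noteq> c (Inl (fst p)) \<and> ce p q \<noteq> c (Inl (fst q))" if "(p, q) \<in> D" for p q
      proof -
        have pq: "(fst p, fst q) \<in> parcs G" using that by (cases p; cases q) (simp add: D_iff)
        have "c (Inl (fst p)) < m + 1" "c (Inl (fst q)) < m + 1"
          using G(5)[OF pq] cV_lt by blast+
        then show ?thesis
          using cVE[OF pq] w_0[OF pq, of "f (snd p) (snd q)"]
          by (cases "f (snd p) (snd q) = 0") (simp add: ce_def w_def, auto simp: ce_def)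
      qed
      show "line_coloring D (m * d + 1) ce"
        unfolding line_coloring_def
      proof (intro conjI allI impI)
        fix p q assume "(p, q) \<in> D"
        then show "ce p q < m * d + 1"
          using w_lt line_coloringD(1)[OF f] by (cases p; cases q) (auto simp: D_iff ce_def)
      next
        fix p q q' assume *: "(p, q) \<in> D" "(p, q') \<in> D" "ce p q = ce p q'"
        obtain u a v b v' b' where pq: "p = (u, a)" "q = (v, b)" "q' = (v', b')"
          by (cases p; cases q; cases q')
        have arcs: "(u, v) \<in> parcs G" "(u, v') \<in> parcs G" "(a, b) \<in> parcs H" "(a, b') \<in> parcs H"
          using * by (auto simp: pq D_iff)
        \<comment> \<open>Equal colours lie in the same block, hence over the same matching of
          \<open>H\<close>. This gives \<open>b = b'\<close>, and then the line colouring
          \<open>w i\<close> within that class gives \<open>v = v'\<close>.\<close>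
        have eq: "f a b = f a b'" using w_index[OF arcs(1,2)] *(3) by (simp add: pq ce_def)
        then have "b = b'" using line_coloringD(2)[OF f arcs(3,4)] by simp
        moreover have "v = v'"
          using line_coloringD(2)[OF w_line[OF line_coloringD(1)[OF f arcs(3)]] arcs(1,2)] *(3) eq
          by (simp add: pq ce_def)
        ultimately show "q = q'" by (simp add: pq)
      next
        fix p p' q assume *: "(p, q) \<in> D" "(p', q) \<in> D" "ce p q = ce p' q"
        obtain u a v b u' a' where pq: "p = (u, a)" "q = (v, b)" "p' = (u', a')"
          by (cases p; cases q; cases p')
        have arcs: "(u, v) \<in> parcs G" "(u', v) \<in> parcs G" "(a, b) \<in> parcs H" "(a', b) \<in> parcs H"
          using * by (auto simp: pq D_iff)
        have eq: "f a b = f a' b" using w_index[OF arcs(1,2)] *(3) by (simp add: pq ce_def)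
        then have "a = a'" using line_coloringD(3)[OF f arcs(3,4)] by simp
        moreover have "u = u'"
          using line_coloringD(3)[OF w_line[OF line_coloringD(1)[OF f arcs(3)]] arcs(1,2)] *(3) eq
          by (simp add: pq ce_def)
        ultimately show "p = p'" by (simp add: pq)
      qed
    qed
  qed
  then show ?thesis
    by (simp add: type_1_iff[OF P] max_degree_direct_product[OF assms(1,2)] m_def d_def)
qed

end
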